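(* For all integers $t,s\ge 2$, $R^3(HK_t,HK_s)\le 2st(s+t)$.
   Context: For a graph $G=(V,E)$, its 3-expansion $HG$ is the 3-uniform hypergraph obtained by adding to each edge $e\in E$ a new vertex $u_e$, distinct for distinct edges; i.e. $V(HG)=V\cup\{u_e:e\in E\}$ and $E(HG)=\{e\cup\{u_e\}: e\in E\}$. $K_n$ is the complete graph on $n$ vertices. For 3-uniform hypergraphs $\mathcal{F}_1,\mathcal{F}_2$, $R^3(\mathcal{F}_1,\mathcal{F}_2)$ is the least $N$ such that every 2-coloring of the hyperedges of the complete 3-uniform hypergraph on $N$ vertices contains a subhypergraph of the first color isomorphic to $\mathcal{F}_1$ or one of the second color isomorphic to $\mathcal{F}_2$. *)

theory Defs
  imports "HOL-Library.Ramsey"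
begin

type_synonym 'a hypergraph = "'a set \<times> 'a set set"

abbreviation verts :: "'a hypergraph \<Rightarrow> 'a set" where
  "verts H \<equiv> fst H"

abbreviation edges :: "'a hypergraph \<Rightarrow> 'a set set" where
  "edges H \<equiv> snd H"

definition uniform_hypergraph :: "nat \<Rightarrow> 'a hypergraph \<Rightarrow> bool" where
  "uniform_hypergraph r H \<longleftrightarrow> finite (verts H) \<and> edges H \<subseteq> [verts H]\<^bsup>r\<^esup>"

definition complete_hypergraph :: "nat \<Rightarrow> nat \<Rightarrow> nat hypergraph" where
  "complete_hypergraph r n = ({..<n}, [{..<n}]\<^bsup>r\<^esup>)"

definition complete_graph :: "nat \<Rightarrow> nat hypergraph" where
  "complete_graph n = complete_hypergraph 2 n"

text \<open>The new vertex \<open>u\<^sub>e\<close> is \<open>Inr e\<close>; an old vertex \<open>v\<close> becomes \<open>Inl v\<close>.\<close>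

definition expansion3 :: "'a hypergraph \<Rightarrow> ('a + 'a set) hypergraph" where
  "expansion3 G =
    (Inl ` verts G \<union> Inr ` edges G, (\<lambda>e. Inl ` e \<union> {Inr e}) ` edges G)"

definition hypergraph_iso :: "'a hypergraph \<Rightarrow> 'b hypergraph \<Rightarrow> bool" where
  "hypergraph_iso F H \<longleftrightarrow>
    (\<exists>f. bij_betw f (verts F) (verts H) \<and> (\<lambda>e. f ` e) ` edges F = edges H)"

definition subhypergraph :: "'a hypergraph \<Rightarrow> 'a hypergraph \<Rightarrow> bool" where
  "subhypergraph S H \<longleftrightarrow>
    verts S \<subseteq> verts H \<and> edges S \<subseteq> edges H \<and> (\<forall>e\<in>edges S. e \<subseteq> verts S)"

definition contains_coloured_copy ::
    "'a hypergraph \<Rightarrow> ('a set \<Rightarrow> bool) \<Rightarrow> bool \<Rightarrow> 'b hypergraph \<Rightarrow> bool" where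
  "contains_coloured_copy H c b F \<longleftrightarrow>
    (\<exists>S. subhypergraph S H \<and> (\<forall>e\<in>edges S. c e = b) \<and> hypergraph_iso F S)"

text \<open>Colourings are total functions on sets; only their values on hyperedges matter.
  \<open>True\<close> is the first colour, \<open>False\<close> the second.\<close>

definition ramsey3_arrows :: "nat \<Rightarrow> 'a hypergraph \<Rightarrow> 'b hypergraph \<Rightarrow> bool" where
  "ramsey3_arrows N F1 F2 \<longleftrightarrow>
    (\<forall>c. contains_coloured_copy (complete_hypergraph 3 N) c True F1 \<or>
         contains_coloured_copy (complete_hypergraph 3 N) c False F2)"

definition ramsey3 :: "'a hypergraph \<Rightarrow> 'b hypergraph \<Rightarrow> nat" where
  "ramsey3 F1 F2 = (LEAST N. ramsey3_arrows N F1 F2)"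

lemma uniform_expansion3:
  assumes "uniform_hypergraph 2 G"
  shows "uniform_hypergraph 3 (expansion3 G)"
proof -
  have fin: "finite (edges G)"
    using assms unfolding uniform_hypergraph_def
    by (meson finite_imp_finite_nsets finite_subset)
  have "Inl ` e \<union> {Inr e} \<in> [verts (expansion3 G)]\<^bsup>3\<^esup>" if "e \<in> edges G" for e
  proof -
    have e: "e \<subseteq> verts G" "finite e" "card e = 2"
      using assms that by (auto simp: uniform_hypergraph_def nsets_def)
    have "card (Inl ` e \<union> {Inr e} :: ('a + 'a set) set) = 3"
      using e by (simp add: card_insert_if card_image image_iff)
    with e that show ?thesis by (auto simp: expansion3_def nsets_def)
  qed
  with assms fin show ?thesis
    by (auto simp: uniform_hypergraph_def expansion3_def)
qed

lemma contains_coloured_copyI: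
  assumes F: "uniform_hypergraph 3 F" and A: "A \<in> [{..<N}]\<^bsup>card (verts F)\<^esup>"
    and col: "\<And>e. e \<in> [A]\<^bsup>3\<^esup> \<Longrightarrow> c e = b"
  shows "contains_coloured_copy (complete_hypergraph 3 N) c b F"
proof -
  have finA: "finite A" and subA: "A \<subseteq> {..<N}" and "card A = card (verts F)"
    using A by (auto simp: nsets_def)
  then obtain f where f: "bij_betw f (verts F) A"
    using F by (metis finite_same_card_bij uniform_hypergraph_def)
  let ?S = "(A, (\<lambda>e. f ` e) ` edges F)"
  have im: "f ` e \<in> [A]\<^bsup>3\<^esup>" if "e \<in> edges F" for e
    using bij_betw_nsets[OF f, of 3] F that
    by (auto simp: uniform_hypergraph_def bij_betw_def)
  have "subhypergraph ?S (complete_hypergraph 3 N)"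
    unfolding subhypergraph_def complete_hypergraph_def
    using im subA nsets_mono[OF subA, of 3] by (auto simp: nsets_def)
  moreover have "hypergraph_iso F ?S"
    using f by (auto simp: hypergraph_iso_def)
  ultimately show ?thesis
    using im col unfolding contains_coloured_copy_def by (intro exI[of _ ?S]) auto
qed

text \<open>By Ramsey's theorem the \<open>LEAST\<close> in the definition of \<open>ramsey3\<close> is attained.\<close>

lemma ramsey3_arrows_ramsey3:
  assumes F1: "uniform_hypergraph 3 F1" and F2: "uniform_hypergraph 3 F2"
  shows "ramsey3_arrows (ramsey3 F1 F2) F1 F2"
proof -
  obtain N :: nat where N: "partn_lst {..<N} [card (verts F1), card (verts F2)] 3"
    using ramsey_full by blast
  have "ramsey3_arrows N F1 F2"
    unfolding ramsey3_arrows_def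
  proof
    fix c :: "nat set \<Rightarrow> bool"
    let ?g = "\<lambda>e. if c e then 0 else 1 :: nat"
    have "?g \<in> [{..<N}]\<^bsup>3\<^esup> \<rightarrow> {..<length [card (verts F1), card (verts F2)]}" by auto
    with N obtain i A where "i < length [card (verts F1), card (verts F2)]"
      and A: "A \<in> [{..<N}]\<^bsup>([card (verts F1), card (verts F2)] ! i)\<^esup>"
      and m: "?g ` [A]\<^bsup>3\<^esup> \<subseteq> {i}"
      unfolding partn_lst_def monochromatic_def by blast
    then have i: "i < 2" by simp
    show "contains_coloured_copy (complete_hypergraph 3 N) c True F1 \<or>
          contains_coloured_copy (complete_hypergraph 3 N) c False F2"
    proof (cases "i = 0")
      case True
      then have "A \<in> [{..<N}]\<^bsup>card (verts F1)\<^esup>" using A by simp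
      moreover have "c e = True" if "e \<in> [A]\<^bsup>3\<^esup>" for e
        using m that True by (auto simp: image_subset_iff split: if_splits)
      ultimately show ?thesis using contains_coloured_copyI[OF F1] by blast
    next
      case False
      with i have "i = 1" by simp
      then have "A \<in> [{..<N}]\<^bsup>card (verts F2)\<^esup>" using A by simp
      moreover have "c e = False" if "e \<in> [A]\<^bsup>3\<^esup>" for e
        using m that \<open>i = 1\<close> by (auto simp: image_subset_iff split: if_splits)
      ultimately show ?thesis using contains_coloured_copyI[OF F2] by blast
    qed
  qed
  then show ?thesis unfolding ramsey3_def by (rule LeastI)
qed

end

theory Submission
  imports Defs
begin

text \<open>
  Let \<open>F\<close> and \<open>G\<close> be graphs on \<open>t\<close> and \<open>s\<close> vertices. Call a pair of vertices light in a colour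
  if few triples of that colour contain it: fewer than \<open>t\<^sup>2\<close> for the first colour, fewer than
  \<open>s\<^sup>2\<close> for the second. If some \<open>t\<close> vertices span no pair that is light in the first colour, then
  \<open>F\<close> can be placed on them and the new vertices chosen greedily, because \<open>t + |E(F)| \<le> t\<^sup>2\<close>,
  which gives a copy of \<open>HF\<close>; likewise for \<open>G\<close> and the second colour. Otherwise both graphs
  of light pairs have small independence number, so in each of them fewer than half of the
  vertices have small degree, and some vertex \<open>v\<close> has large degree in both. Let \<open>A\<close> and \<open>B\<close>
  be its neighbourhoods for the second and the first colour. Every triple \<open>{v, x, y}\<close> with
  \<open>x \<in> A\<close> and \<open>y \<in> B\<close> either has the second colour and is counted at the light pair \<open>{v, x}\<close>,
  or has the first and is counted at \<open>{v, y}\<close>. There are too many such triples for this.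
\<close>

lemma distinct_representatives_if_large:
  assumes "finite I" "\<And>i. i \<in> I \<Longrightarrow> card I \<le> card (W i)"
  shows "\<exists>g. inj_on g I \<and> (\<forall>i\<in>I. g i \<in> W i)"
  using assms
proof (induction I rule: finite_induct)
  case empty
  then show ?case by simp
next
  case (insert j I)
  then obtain g where g: "inj_on g I" "\<And>i. i \<in> I \<Longrightarrow> g i \<in> W i"
    by (metis card_insert_disjoint insertI2 Suc_leD)
  have "card (g ` I) < card (W j)"
    using insert.prems[of j] insert.hyps card_image_le[of I g] by simp
  then obtain w where w: "w \<in> W j" "w \<notin> g ` I"
    using insert.hyps(1) by (metis card_mono finite_imageI not_le subsetI)
  have "inj_on (g(j := w)) (insert j I)"
    using g(1) w(2) insert.hyps(2) by (auto simp: inj_on_def)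
  moreover have "\<forall>i\<in>insert j I. (g(j := w)) i \<in> W i"
    using g(2) w(1) by auto
  ultimately show ?case by blast
qed

lemma card_mult_less_if_bipartite_degrees:
  assumes "finite A" "finite B" "B \<noteq> {}"
    and row: "\<And>x. x \<in> A \<Longrightarrow> card {y \<in> B. R x y} \<le> p"
    and col: "\<And>y. y \<in> B \<Longrightarrow> card {x \<in> A. \<not> R x y} < q"
  shows "card A * card B < card A * p + card B * q"
proof -
  have split: "card B = card {y \<in> B. R x y} + card {y \<in> B. \<not> R x y}" for x
  proof -
    have "B = {y \<in> B. R x y} \<union> {y \<in> B. \<not> R x y}" by blast
    then show ?thesis
      using card_Un_disjoint[of "{y \<in> B. R x y}" "{y \<in> B. \<not> R x y}"] \<open>finite B\<close> by auto
  qed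
  have "card A * card B = (\<Sum>x\<in>A. card {y \<in> B. R x y} + card {y \<in> B. \<not> R x y})"
    by (simp flip: split)
  also have "\<dots> = (\<Sum>x\<in>A. card {y \<in> B. R x y}) + (\<Sum>x\<in>A. card {y \<in> B. \<not> R x y})"
    by (rule sum.distrib)
  also have "(\<Sum>x\<in>A. card {y \<in> B. \<not> R x y}) = (\<Sum>y\<in>B. card {x \<in> A. \<not> R x y})"
    using assms(1,2) by (intro sum_multicount_gen) auto
  also have "(\<Sum>x\<in>A. card {y \<in> B. R x y}) \<le> card A * p"
    using sum_bounded_above[OF row] by simp
  also have "(\<Sum>y\<in>B. card {x \<in> A. \<not> R x y}) < (\<Sum>y\<in>B. q)"
    using assms(2,3) col by (rule sum_strict_mono)
  finally show ?thesis by simp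
qed

lemma mult_squares_add_le_mult_if_large:
  fixes a b s t :: nat
  assumes "t * (s + t) \<le> a" "s * (s + t) \<le> b"
  shows "a * s\<^sup>2 + b * t\<^sup>2 \<le> a * b"
proof (cases "s + t = 0")
  case False
  have "(s + t) * (a * s\<^sup>2 + b * t\<^sup>2) = (a * s) * (s * (s + t)) + (b * t) * (t * (s + t))"
    by (simp add: algebra_simps power2_eq_square)
  also have "\<dots> \<le> (a * s) * b + (b * t) * a"
    using assms by (intro add_mono mult_left_mono) auto
  also have "\<dots> = (s + t) * (a * b)"
    by (simp add: algebra_simps)
  finally show ?thesis
    using False by (simp only: nat_mult_le_cancel1 neq0_conv)
qed simp

definition neighbours :: "'a hypergraph \<Rightarrow> 'a \<Rightarrow> 'a set" where
  "neighbours G v = {u \<in> verts G. {v, u} \<in> edges G}"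

lemma maximal_indep_dominates:
  assumes "L \<subseteq> verts G" "indep K (edges G)"
    and maximal: "\<And>u. u \<in> L - K \<Longrightarrow> \<not> indep (insert u K) (edges G)"
  shows "L \<subseteq> (\<Union>v\<in>K. insert v (neighbours G v))"
proof
  fix u assume "u \<in> L"
  show "u \<in> (\<Union>v\<in>K. insert v (neighbours G v))"
  proof (cases "u \<in> K")
    case False
    then obtain v where "v \<in> K" "{v, u} \<in> edges G"
      using maximal[of u] \<open>u \<in> L\<close> \<open>indep K (edges G)\<close>
      by (auto simp: indep_def insert_commute)
    then show ?thesis
      using \<open>u \<in> L\<close> \<open>L \<subseteq> verts G\<close> by (auto simp: neighbours_def)
  qed blast
qed

lemma indep_subset_if_bounded_degree:
  assumes "finite (verts G)" "L \<subseteq> verts G" "D > 0"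
    and degree: "\<And>v. v \<in> L \<Longrightarrow> card (neighbours G v) < D"
    and large: "n * D \<le> card L"
  obtains K where "K \<subseteq> L" "card K = n" "indep K (edges G)"
proof -
  define \<I> where "\<I> = {K. K \<subseteq> L \<and> indep K (edges G)}"
  have "finite L" using assms(1,2) finite_subset by blast
  then have "finite \<I>" by (simp add: \<I>_def)
  moreover have "{} \<in> \<I>" by (simp add: \<I>_def)
  ultimately obtain M where "M \<in> \<I>" and maximal: "\<And>K. K \<in> \<I> \<Longrightarrow> M \<subseteq> K \<Longrightarrow> M = K"
    using finite_has_maximal[of \<I>] by blast
  then have M: "M \<subseteq> L" "indep M (edges G)" by (auto simp: \<I>_def)
  have "finite M" using M(1) \<open>finite L\<close> finite_subset by blast
  have fin: "finite (neighbours G v)" for v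
    using assms(1) by (simp add: neighbours_def)
  have "\<not> indep (insert u M) (edges G)" if "u \<in> L - M" for u
    using maximal[of "insert u M"] M(1) that by (auto simp: \<I>_def)
  then have "L \<subseteq> (\<Union>v\<in>M. insert v (neighbours G v))"
    by (rule maximal_indep_dominates[OF assms(2) M(2)])
  then have "n * D \<le> card (\<Union>v\<in>M. insert v (neighbours G v))"
    using \<open>finite M\<close> fin by (intro order_trans[OF large] card_mono) auto
  also have "\<dots> \<le> (\<Sum>v\<in>M. card (insert v (neighbours G v)))"
    using \<open>finite M\<close> by (rule card_UN_le)
  also have "\<dots> \<le> (\<Sum>v\<in>M. D)"
  proof (rule sum_mono)
    fix v assume "v \<in> M"
    then show "card (insert v (neighbours G v)) \<le> D"
      using degree[of v] M(1) fin by (auto simp: card_insert_if)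
  qed
  finally have "n \<le> card M" using \<open>D > 0\<close> by simp
  then obtain K where "K \<subseteq> M" "card K = n"
    by (rule obtain_subset_with_card_n)
  with M that[of K] smaller_indep[of M "edges G" K] show thesis by auto
qed

lemma uniform_complete_hypergraph: "uniform_hypergraph r (complete_hypergraph r n)"
  by (simp add: uniform_hypergraph_def complete_hypergraph_def)

lemma uniform_complete_graph: "uniform_hypergraph 2 (complete_graph n)"
  unfolding complete_graph_def by (rule uniform_complete_hypergraph)

lemma finite_edges_if_uniform: "uniform_hypergraph r G \<Longrightarrow> finite (edges G)"
  unfolding uniform_hypergraph_def by (meson finite_imp_finite_nsets finite_subset)

lemma card_verts_add_card_edges_le:
  assumes "uniform_hypergraph 2 G"
  shows "card (verts G) + card (edges G) \<le> (card (verts G))\<^sup>2"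
proof -
  let ?n = "card (verts G)"
  have "card (edges G) \<le> card ([verts G]\<^bsup>2\<^esup>)"
    using assms by (intro card_mono finite_imp_finite_nsets) (simp_all add: uniform_hypergraph_def)
  also have "\<dots> = ?n * (?n - 1) div 2"
    by (simp add: choose_two)
  also have "\<dots> \<le> ?n * (?n - 1)" by (rule div_le_dividend)
  finally have "card (verts G) + card (edges G) \<le> ?n + ?n * (?n - 1)" by simp
  also have "\<dots> = ?n\<^sup>2" by (cases ?n) (simp_all add: power2_eq_square)
  finally show ?thesis .
qed

lemma contains_coloured_copy_if_embedding:
  assumes F: "uniform_hypergraph r F"
    and f: "inj_on f (verts F)" "f ` verts F \<subseteq> {..<N}"
    and colour: "\<And>e. e \<in> edges F \<Longrightarrow> c (f ` e) = b"
  shows "contains_coloured_copy (complete_hypergraph r N) c b F"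
proof -
  let ?S = "(f ` verts F, (\<lambda>e. f ` e) ` edges F)"
  have "f ` e \<in> [f ` verts F]\<^bsup>r\<^esup>" if "e \<in> edges F" for e
  proof -
    have "e \<in> [verts F]\<^bsup>r\<^esup>" using F that by (auto simp: uniform_hypergraph_def)
    then show ?thesis
      using f(1) by (auto simp: nsets_def card_image inj_on_subset)
  qed
  then have "subhypergraph ?S (complete_hypergraph r N)"
    using f(2) nsets_mono[OF f(2), of r]
    by (auto simp: subhypergraph_def complete_hypergraph_def nsets_def)
  moreover have "hypergraph_iso F ?S"
    using f(1) by (auto simp: hypergraph_iso_def bij_betw_def)
  moreover have "\<forall>e\<in>edges ?S. c e = b" using colour by simp
  ultimately show ?thesis
    unfolding contains_coloured_copy_def by blast
qed

lemma inj_on_case_sum: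
  assumes "inj_on h A" "inj_on g B" "h ` A \<inter> g ` B = {}"
  shows "inj_on (case_sum h g) (Inl ` A \<union> Inr ` B)"
proof -
  have "inj_on (case_sum h g) (Inl ` A)" "inj_on (case_sum h g) (Inr ` B)"
    using assms(1,2) by (auto intro: inj_on_imageI simp: comp_def)
  moreover have "case_sum h g ` Inl ` A = h ` A" "case_sum h g ` Inr ` B = g ` B"
    by (simp_all add: image_image)
  ultimately show ?thesis
    using assms(3) by (simp only: inj_on_Un) blast
qed

definition extensions :: "'a set \<Rightarrow> ('a set \<Rightarrow> bool) \<Rightarrow> bool \<Rightarrow> 'a set \<Rightarrow> 'a set" where
  "extensions V c b e = {z \<in> V - e. c (insert z e) = b}"

lemma contains_coloured_copy_expansion3_if_extensions:
  assumes G: "uniform_hypergraph 2 G"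
    and h: "inj_on h (verts G)" "h ` verts G \<subseteq> {..<N}"
    and g: "inj_on g (edges G)"
      "\<And>e. e \<in> edges G \<Longrightarrow> g e \<in> extensions {..<N} c b (h ` e) - h ` verts G"
  shows "contains_coloured_copy (complete_hypergraph 3 N) c b (expansion3 G)"
proof (rule contains_coloured_copy_if_embedding)
  let ?f = "case_sum h g"
  have new: "g e \<in> {..<N} - h ` verts G" "c (insert (g e) (h ` e)) = b"
    if "e \<in> edges G" for e
    using g(2)[OF that] by (simp_all add: extensions_def)
  show "uniform_hypergraph 3 (expansion3 G)"
    using G by (rule uniform_expansion3)
  show "inj_on ?f (verts (expansion3 G))"
  proof -
    have "g ` edges G \<subseteq> {..<N} - h ` verts G" using new(1) by (rule image_subsetI)
    then have "h ` verts G \<inter> g ` edges G = {}" by blast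
    with h(1) g(1) show ?thesis
      by (simp add: expansion3_def inj_on_case_sum)
  qed
  show "?f ` verts (expansion3 G) \<subseteq> {..<N}"
    using h(2) new(1) by (auto simp: expansion3_def)
  show "c (?f ` d) = b" if "d \<in> edges (expansion3 G)" for d
  proof -
    obtain e where "e \<in> edges G" and d: "d = Inl ` e \<union> {Inr e}"
      using \<open>d \<in> edges (expansion3 G)\<close> by (auto simp: expansion3_def)
    have "?f ` d = insert (g e) (h ` e)" by (simp add: d image_Un image_image)
    then show ?thesis using new(2)[OF \<open>e \<in> edges G\<close>] by simp
  qed
qed

lemma contains_coloured_copy_expansion3_if_codegrees:
  assumes G: "uniform_hypergraph 2 G"
    and h: "inj_on h (verts G)" "h ` verts G \<subseteq> {..<N}"
    and heavy: "\<And>e. e \<in> edges G \<Longrightarrow>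
      card (verts G) + card (edges G) \<le> card (extensions {..<N} c b (h ` e))"
  shows "contains_coloured_copy (complete_hypergraph 3 N) c b (expansion3 G)"
proof -
  let ?W = "\<lambda>e. extensions {..<N} c b (h ` e) - h ` verts G"
  have "card (edges G) \<le> card (?W e)" if "e \<in> edges G" for e
  proof -
    have "card (edges G) \<le> card (extensions {..<N} c b (h ` e)) - card (h ` verts G)"
      using heavy[OF that] h(1) by (simp add: card_image)
    also have "\<dots> \<le> card (?W e)"
      using h(2) finite_subset by (intro diff_card_le_card_Diff) blast
    finally show ?thesis .
  qed
  then have "\<exists>g. inj_on g (edges G) \<and> (\<forall>e\<in>edges G. g e \<in> ?W e)"
    using finite_edges_if_uniform[OF G] by (intro distinct_representatives_if_large)
  then obtain g where g: "inj_on g (edges G)" "\<forall>e\<in>edges G. g e \<in> ?W e"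
    by (elim exE conjE)
  show ?thesis
    using g(2) by (intro contains_coloured_copy_expansion3_if_extensions[OF G h g(1)]) simp
qed

definition light_graph ::
    "'a set \<Rightarrow> ('a set \<Rightarrow> bool) \<Rightarrow> bool \<Rightarrow> nat \<Rightarrow> 'a hypergraph" where
  "light_graph V c b m = (V, {e \<in> [V]\<^bsup>2\<^esup>. card (extensions V c b e) < m})"

lemma mem_neighbours_light_graph:
  "u \<in> neighbours (light_graph V c b m) v \<longleftrightarrow>
    v \<in> V \<and> u \<in> V \<and> u \<noteq> v \<and> card (extensions V c b {v, u}) < m"
  by (auto simp: neighbours_def light_graph_def)

lemma contains_coloured_copy_expansion3_if_indep_light_graph:
  assumes G: "uniform_hypergraph 2 G"
    and m: "card (verts G) + card (edges G) \<le> m"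
    and K: "K \<subseteq> {..<N}" "card K = card (verts G)"
    and indep: "indep K (edges (light_graph {..<N} c b m))"
  shows "contains_coloured_copy (complete_hypergraph 3 N) c b (expansion3 G)"
proof -
  have "finite K" using K(1) finite_subset by blast
  then obtain h where h: "bij_betw h (verts G) K"
    using G K(2) by (metis finite_same_card_bij uniform_hypergraph_def)
  have "card (verts G) + card (edges G) \<le> card (extensions {..<N} c b (h ` e))"
    if "e \<in> edges G" for e
  proof -
    have "e \<in> [verts G]\<^bsup>2\<^esup>" using G that by (auto simp: uniform_hypergraph_def)
    then have "h ` e \<in> [K]\<^bsup>2\<^esup>"
      using bij_betw_nsets[OF h, of 2] by (auto simp: bij_betw_def)
    then obtain x y where xy: "h ` e = {x, y}" "x \<in> K" "y \<in> K" "x \<noteq> y"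
      by (elim nsets2_E)
    then have "{x, y} \<notin> edges (light_graph {..<N} c b m)"
      using indep by (auto simp: indep_def)
    then have "m \<le> card (extensions {..<N} c b {x, y})"
      using xy K(1) by (auto simp: light_graph_def)
    with m xy(1) show ?thesis by simp
  qed
  then show ?thesis
    using h K(1) by (intro contains_coloured_copy_expansion3_if_codegrees[OF G, of h])
      (auto simp: bij_betw_def)
qed

lemma card_low_degree_light_graph_less:
  assumes "uniform_hypergraph 2 G" "card (verts G) + card (edges G) \<le> m" "D > 0"
    and no_copy: "\<not> contains_coloured_copy (complete_hypergraph 3 N) c b (expansion3 G)"
  shows "card {v \<in> {..<N}. card (neighbours (light_graph {..<N} c b m) v) < D}
    < card (verts G) * D"
proof (rule ccontr)
  let ?H = "light_graph {..<N} c b m"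
  let ?L = "{v \<in> {..<N}. card (neighbours ?H v) < D}"
  assume "\<not> card ?L < card (verts G) * D"
  then have "card (verts G) * D \<le> card ?L" by simp
  moreover have "finite (verts ?H)" "?L \<subseteq> verts ?H" by (auto simp: light_graph_def)
  ultimately obtain K where "K \<subseteq> ?L" "card K = card (verts G)" "indep K (edges ?H)"
    using \<open>D > 0\<close> indep_subset_if_bounded_degree[of ?H ?L D "card (verts G)"] by blast
  then have "contains_coloured_copy (complete_hypergraph 3 N) c b (expansion3 G)"
    using assms(1,2)
    by (intro contains_coloured_copy_expansion3_if_indep_light_graph) auto
  with no_copy show False by blast
qed

lemma card_light_neighbours_mult_less:
  fixes V :: "'a set" and c :: "'a set \<Rightarrow> bool" and b :: bool and v :: 'a and p q :: nat
  assumes "finite V"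
  defines "A \<equiv> neighbours (light_graph V c b p) v"
    and "B \<equiv> neighbours (light_graph V c (\<not> b) q) v"
  assumes "B \<noteq> {}"
  shows "card A * card B < card A * p + card B * q"
proof (rule card_mult_less_if_bipartite_degrees)
  have sub: "A \<subseteq> V - {v}" "B \<subseteq> V - {v}"
    by (auto simp: A_def B_def mem_neighbours_light_graph)
  then show "finite A" "finite B" using \<open>finite V\<close> finite_subset by blast+
  show "B \<noteq> {}" by fact
  have fin: "finite (extensions V c b' e)" for b' e
    using \<open>finite V\<close> by (simp add: extensions_def)
  show "card {y \<in> B. y = x \<or> c {v, x, y} = b} \<le> p" if "x \<in> A" for x
  proof -
    have "{y \<in> B. y = x \<or> c {v, x, y} = b} \<subseteq> insert x (extensions V c b {v, x})"
      using sub(2) by (auto simp: extensions_def insert_commute)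
    then have "card {y \<in> B. y = x \<or> c {v, x, y} = b} \<le> card (insert x (extensions V c b {v, x}))"
      using fin by (intro card_mono) auto
    also have "\<dots> \<le> Suc (card (extensions V c b {v, x}))"
      using fin by (simp add: card_insert_if)
    also have "\<dots> \<le> p"
      using that by (simp add: A_def mem_neighbours_light_graph Suc_leI)
    finally show ?thesis .
  qed
  show "card {x \<in> A. \<not> (y = x \<or> c {v, x, y} = b)} < q" if "y \<in> B" for y
  proof -
    have "{x \<in> A. \<not> (y = x \<or> c {v, x, y} = b)} \<subseteq> extensions V c (\<not> b) {v, y}"
      using sub(1) by (auto simp: extensions_def insert_commute)
    then have "card {x \<in> A. \<not> (y = x \<or> c {v, x, y} = b)} \<le> card (extensions V c (\<not> b) {v, y})"
      using fin by (intro card_mono)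
    also have "\<dots> < q"
      using that by (simp add: B_def mem_neighbours_light_graph)
    finally show ?thesis .
  qed
qed

lemma light_degree_less_if_opposite_large:
  fixes s t :: nat
  assumes "finite V" "s > 0"
    and large: "t * (s + t) \<le> card (neighbours (light_graph V c b (s\<^sup>2)) v)"
  shows "card (neighbours (light_graph V c (\<not> b) (t\<^sup>2)) v) < s * (s + t)"
proof (rule ccontr)
  let ?A = "neighbours (light_graph V c b (s\<^sup>2)) v"
  let ?B = "neighbours (light_graph V c (\<not> b) (t\<^sup>2)) v"
  assume "\<not> card ?B < s * (s + t)"
  then have large_B: "s * (s + t) \<le> card ?B" by simp
  then have "?B \<noteq> {}" using \<open>s > 0\<close> by auto
  then have "card ?A * card ?B < card ?A * s\<^sup>2 + card ?B * t\<^sup>2"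
    using \<open>finite V\<close> by (intro card_light_neighbours_mult_less)
  also have "\<dots> \<le> card ?A * card ?B"
    using large large_B by (rule mult_squares_add_le_mult_if_large)
  finally show False by simp
qed

lemma ramsey3_arrows_expansion3:
  assumes F: "uniform_hypergraph 2 F" "card (verts F) = t" "t > 0"
    and G: "uniform_hypergraph 2 G" "card (verts G) = s" "s > 0"
  shows "ramsey3_arrows (2 * s * t * (s + t)) (expansion3 F) (expansion3 G)"
  unfolding ramsey3_arrows_def
proof (intro allI, rule ccontr)
  fix c :: "nat set \<Rightarrow> bool"
  let ?V = "{..<2 * s * t * (s + t)}"
  let ?copy = "contains_coloured_copy (complete_hypergraph 3 (2 * s * t * (s + t))) c"
  assume "\<not> (?copy True (expansion3 F) \<or> ?copy False (expansion3 G))"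
  then have no_F: "\<not> ?copy True (expansion3 F)" and no_G: "\<not> ?copy False (expansion3 G)"
    by auto
  let ?A = "neighbours (light_graph ?V c False (s\<^sup>2))"
  let ?B = "neighbours (light_graph ?V c True (t\<^sup>2))"
  let ?lowA = "{v \<in> ?V. card (?A v) < t * (s + t)}"
  let ?lowB = "{v \<in> ?V. card (?B v) < s * (s + t)}"
  have "card ?lowA < s * (t * (s + t))"
    using card_low_degree_light_graph_less[OF G(1) _ _ no_G, of "s\<^sup>2"]
      card_verts_add_card_edges_le[OF G(1)] F(2,3) G(2,3) by simp
  moreover have "card ?lowB < t * (s * (s + t))"
    using card_low_degree_light_graph_less[OF F(1) _ _ no_F, of "t\<^sup>2"]
      card_verts_add_card_edges_le[OF F(1)] F(2,3) G(2,3) by simp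
  moreover have "s * (t * (s + t)) + t * (s * (s + t)) = card ?V"
    by (simp add: algebra_simps)
  ultimately have "card (?lowA \<union> ?lowB) < card ?V"
    using card_Un_le[of ?lowA ?lowB] by linarith
  then have "\<not> ?V \<subseteq> ?lowA \<union> ?lowB"
    using card_mono[of "?lowA \<union> ?lowB" ?V] by auto
  then obtain v where "v \<in> ?V" "v \<notin> ?lowA \<union> ?lowB" by blast
  then show False
    using light_degree_less_if_opposite_large[of ?V s t c False v] \<open>s > 0\<close> by auto
qed

theorem theorem1p11:
  fixes s t :: nat
  assumes "t \<ge> 2" and "s \<ge> 2"
  shows "ramsey3 (expansion3 (complete_graph t)) (expansion3 (complete_graph s))
           \<le> 2 * s * t * (s + t)"
  unfolding ramsey3_def
proof (intro Least_le ramsey3_arrows_expansion3)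
  show "card (verts (complete_graph t)) = t" "card (verts (complete_graph s)) = s"
    by (simp_all add: complete_graph_def complete_hypergraph_def)
qed (use assms uniform_complete_graph in auto)

end
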